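(* Let $C : \mathsf{Form} \to \mathsf{Prop}$ be any predicate such that for all formulas $A,B$, $C(A \to B)$ and $C(A)$ imply $C(B)$, and such that $C(\bot)$ does not hold. Suppose there is a formula $B$ with $B \simeq_C \neg B$, and suppose there exists a function $d : \mathsf{Form} \to \{\mathsf{tt},\mathsf{ff}\}$ such that for every formula $A$, $d(A) = \mathsf{tt}$ implies $C(A)$ and $d(A) = \mathsf{ff}$ implies $C(\neg A)$. Then a contradiction follows.
   Context: $\mathsf{Form}$ is the type of closed formulas generated by $A,B ::= \bot \mid A \to B$; $\neg A$ abbreviates $A \to \bot$. For a predicate $C$ on $\mathsf{Form}$, $A \simeq_C B$ means $C(A \to B) \land C(B \to A)$. *)

theory Defs
  imports Main
begin

datatype form = Falsum | Imp form form  (infixr "\<rightarrow>\<^sub>F" 55)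

abbreviation Neg :: "form \<Rightarrow> form" where
  "Neg A \<equiv> A \<rightarrow>\<^sub>F Falsum"

definition equiv_under :: "(form \<Rightarrow> bool) \<Rightarrow> form \<Rightarrow> form \<Rightarrow> bool" where
  "equiv_under C A B \<longleftrightarrow> C (A \<rightarrow>\<^sub>F B) \<and> C (B \<rightarrow>\<^sub>F A)"

end

theory Submission
  imports Defs
begin

text \<open>This is the liar argument. A fixed point \<open>B\<close> of negation lets modus ponens
  carry \<open>C\<close> from \<open>B\<close> to \<open>Neg B\<close> and back, so either verdict
  of the decider on \<open>B\<close> makes both hold under \<open>C\<close>, contradicting
  consistency.\<close>

theorem theorem3p13:
  fixes C :: "form \<Rightarrow> bool"
  assumes modus_ponens: "\<And>A B. C (A \<rightarrow>\<^sub>F B) \<Longrightarrow> C A \<Longrightarrow> C B"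
    and consistent: "\<not> C Falsum"
    and fixed_point: "\<exists>B. equiv_under C B (Neg B)"
    and decider: "\<exists>d :: form \<Rightarrow> bool. \<forall>A.
      (d A = True \<longrightarrow> C A) \<and> (d A = False \<longrightarrow> C (Neg A))"
  shows False
proof -
  from fixed_point obtain B where to_neg: "C (B \<rightarrow>\<^sub>F Neg B)" and from_neg: "C (Neg B \<rightarrow>\<^sub>F B)"
    by (auto simp: equiv_under_def)
  \<comment> \<open>The value \<open>d B\<close> is a boolean, so one of the two soundness clauses
    fires.\<close>
  from decider have "C B \<or> C (Neg B)" by metis
  then have "C B" using modus_ponens[OF from_neg] by blast
  moreover from this have "C (Neg B)" by (rule modus_ponens[OF to_neg])
  \<comment> \<open>\<open>Neg B\<close> is itself the implication from \<open>B\<close> to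
    \<open>Falsum\<close>.\<close>
  ultimately have "C Falsum" using modus_ponens by blast
  with consistent show False by contradiction
qed

end
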